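(* The $*$-map $\alpha:D_{1}\rightarrow D_{1}$, $\alpha(n)=(-1)\,n\,(1)$, is a complete order map of the matricially ordered $*$-semigroup $D_1$ satisfying the Schwarz inequality for each $k\in\mathbb{N}$. That is, for each $k$: if $[a_{ij}]\preceq[b_{ij}]$ in $\mathcal{M}_k(D_1)$ then $[\alpha(a_{ij})],[\alpha(b_{ij})]\in\mathcal{M}_k(D_1)$ and $[\alpha(a_{ij})]\preceq[\alpha(b_{ij})]$; and for all $n_1,\dots,n_k\in D_1$, $[\alpha(n_i)^*\alpha(n_j)]\preceq[\alpha(n_i^*n_j)]$ in $\mathcal{M}_k(D_1)$.
   Context: A $*$-semigroup is a semigroup with an involutive map $*$ satisfying $(ab)^*=b^*a^*$; $S^{\rm sa}$ denotes its selfadjoint elements; a $*$-map is a map preserving $*$. The $*$-semigroup $A$: let $A_c$ be the set of finite nonempty sequences $(n_0,\dots,n_k)$ of nonzero integers with alternating signs; multiplication is concatenation, where the last entry of the left factor and the first entry of the right factor are added into a single entry if they have the same sign; $(n_0,\dots,n_k)^*=(-n_k,\dots,-n_0)$. $A$ is the quotient of $A_c$ by the congruence generated by $(n_0,\dots,n_k)\sim(n_0,\dots,n_{i-1},n_i+n_{i+1}+n_{i+2},n_{i+3},\dots,n_k)$ whenever $0\le i\le k-2$ and $n_{i+1}=\pm1$. Each element of $A$ has a unique reduced representative $(n_0,\dots,n_k)$, one with $n_j\ne\pm1$ for $1\le j\le k-1$. Let $\tau:A\to\mathbb{Z}$, $\tau(n_0,\dots,n_k)=\sum n_i$ (a homomorphism),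 $A^0=\tau^{-1}(0)$, and let $A_+$ be the set of reduced words with $k\ge1$, $n_0<0$, $n_k>0$. An element $p$ of a semigroup $S$ is irreducible in $S$ if it is not a product of two elements of $S$, or whenever $p=mn$ with $m,n\in S$ then $p=m$ or $p=n$; $\operatorname{Irr}(S)$ is the set of these, and $\operatorname{Irr}_+(A^0)=\operatorname{Irr}(A^0)\cap A_+$. $D_1$ is the $*$-subsemigroup of $A$ generated by $(1,-1)$ and $\operatorname{Irr}_+(A^0)$. The product $(-1)\,n\,(1)$ is taken in $A$. Matricial order: for a row $[w_i]=[w_1,\dots,w_k]$ with entries in $A$, $[w_i]^*[w_j]$ is the $k\times k$ matrix with entries $w_i^*w_j$, and $a[w_i]=[aw_i]$ for $a\in A$. $\mathcal{M}_k(A)$ is the set of all matrices $[w_i]^*[w_j]$. Its partial order $\preceq$ is generated (reflexively and transitively) by: if $(-1,1)[w_i]=[w_i]$ and $[u_i]$ is any row with $[w_i]=(-1)[u_i]$ then $[w_i]^*[w_j]\preceq[u_i]^*[u_j]$; if $(1,-1)[w_i]=[w_i]$ and $[u_i]$ is any row with $[w_i]=(1)[u_i]$ then $[w_i]^*[w_j]\preceq[u_i]^*[u_j]$. $\mathcal{M}_k(D_1)$ is the set of matrices in $\mathcal{M}_k(A)$ with all entries in $D_1$, with the restricted order; $\mathcal{M}_1(D_1)=D_1^{\rm sa}$. *)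

theory Defs
  imports "Jordan_Normal_Form.Matrix"
begin

section \<open>\<open>*\<close>-semigroups\<close>

class star_semigroup = semigroup_mult +
  fixes star :: "'a \<Rightarrow> 'a"
  assumes star_star: "star (star a) = a"
    and star_mult: "star (a * b) = star b * star a"

inductive_set star_subsemigroup_gen :: "'a::star_semigroup set \<Rightarrow> 'a set" for G where
  gen: "a \<in> G \<Longrightarrow> a \<in> star_subsemigroup_gen G"
| mult: "\<lbrakk>a \<in> star_subsemigroup_gen G; b \<in> star_subsemigroup_gen G\<rbrakk>
    \<Longrightarrow> a * b \<in> star_subsemigroup_gen G"
| star: "a \<in> star_subsemigroup_gen G \<Longrightarrow> star a \<in> star_subsemigroup_gen G"

text \<open>This is weaker than irreducibility in the sense of rings: idempotents may be irreducible.\<close>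

definition Irr :: "'a::semigroup_mult set \<Rightarrow> 'a set" where
  "Irr S = {p \<in> S. \<not> (\<exists>m\<in>S. \<exists>n\<in>S. p = m * n) \<or> (\<forall>m\<in>S. \<forall>n\<in>S. p = m * n \<longrightarrow> p = m \<or> p = n)}"


section \<open>Alternating words: the \<open>*\<close>-semigroup \<open>A\<^sub>c\<close>\<close>

definition alt_word :: "int list \<Rightarrow> bool" where
  "alt_word ns \<longleftrightarrow> ns \<noteq> [] \<and> 0 \<notin> set ns \<and> successively (\<lambda>m n. m * n < 0) ns"

definition word_mult :: "int list \<Rightarrow> int list \<Rightarrow> int list" where
  "word_mult ms ns =
    (if sgn (last ms) = sgn (hd ns) then butlast ms @ (last ms + hd ns) # tl ns else ms @ ns)"

definition word_star :: "int list \<Rightarrow> int list" where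
  "word_star ns = rev (map uminus ns)"

lemma alt_word_nonempty: "alt_word ns \<Longrightarrow> ns \<noteq> []"
  by (simp add: alt_word_def)

lemma alt_word_decomp:
  "alt_word (ms @ a # ns) \<longleftrightarrow> a \<noteq> 0 \<and> (ms = [] \<or> alt_word ms \<and> last ms * a < 0) \<and>
     (ns = [] \<or> alt_word ns \<and> a * hd ns < 0)"
  by (auto simp: alt_word_def successively_append_iff successively_Cons)

lemmas alt_word_Cons = alt_word_decomp[where ms = "[]", simplified]
lemmas alt_word_snoc = alt_word_decomp[where ns = "[]", simplified]

lemma word_mult_snoc_Cons:
  "word_mult (ms @ [a]) (b # ns) = (if sgn a = sgn b then ms @ (a + b) # ns else ms @ a # b # ns)"
  by (simp add: word_mult_def)

lemma sgn_add_same: "sgn (a::int) = sgn b \<Longrightarrow> sgn (a + b) = sgn b"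
  by (auto simp: sgn_if split: if_splits)

lemma mult_less_0_same_sgn:
  assumes "sgn (a::int) = sgn b"
  shows "a * x < 0 \<longleftrightarrow> b * x < 0" "x * a < 0 \<longleftrightarrow> x * b < 0"
proof -
  have "a > 0 \<longleftrightarrow> b > 0" "a < 0 \<longleftrightarrow> b < 0"
    using assms by (metis sgn_greater, metis sgn_less)
  then show "a * x < 0 \<longleftrightarrow> b * x < 0" "x * a < 0 \<longleftrightarrow> x * b < 0"
    unfolding mult_less_0_iff by blast+
qed

lemma mult_less_0_diff_sgn:
  assumes "(a::int) \<noteq> 0" "b \<noteq> 0" "sgn a \<noteq> sgn b"
  shows "a * b < 0"
  using assms by (metis mult_less_0_iff linorder_neqE sgn_neg sgn_pos)

lemma alt_word_mult:
  assumes "alt_word ms" "alt_word ns"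
  shows "alt_word (word_mult ms ns)"
proof -
  obtain ms' a where ms: "ms = ms' @ [a]" using assms(1) alt_word_nonempty rev_exhaust by blast
  obtain b ns' where ns: "ns = b # ns'" using assms(2) alt_word_nonempty neq_Nil_conv by metis
  have a: "a \<noteq> 0" "ms' = [] \<or> alt_word ms' \<and> last ms' * a < 0"
    using assms(1) unfolding ms alt_word_snoc by auto
  have b: "b \<noteq> 0" "ns' = [] \<or> alt_word ns' \<and> b * hd ns' < 0"
    using assms(2) unfolding ns alt_word_Cons by auto
  show ?thesis
  proof (cases "sgn a = sgn b")
    case True
    have s: "sgn (a + b) = sgn b" using True by (rule sgn_add_same)
    have "a + b \<noteq> 0" using s b(1) by (metis sgn_0_0)
    moreover have "last ms' * (a + b) < 0 \<longleftrightarrow> last ms' * a < 0"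
      using s True by (intro mult_less_0_same_sgn) simp
    moreover have "(a + b) * hd ns' < 0 \<longleftrightarrow> b * hd ns' < 0"
      using s by (intro mult_less_0_same_sgn)
    ultimately show ?thesis
      using a b True unfolding ms ns word_mult_snoc_Cons if_P[OF True] alt_word_decomp by blast
  next
    case False
    then have "a * b < 0" using a b by (intro mult_less_0_diff_sgn)
    then show ?thesis
      using a b unfolding ms ns word_mult_snoc_Cons if_not_P[OF False] alt_word_decomp alt_word_Cons
      by simp
  qed
qed

lemma alt_word_star: "alt_word (word_star ns) \<longleftrightarrow> alt_word ns"
  by (auto simp: alt_word_def word_star_def successively_map mult.commute)

lemma word_star_star: "word_star (word_star ns) = ns"
  by (simp add: word_star_def rev_map)

lemma word_star_mult:
  assumes "alt_word ms" "alt_word ns"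
  shows "word_star (word_mult ms ns) = word_mult (word_star ns) (word_star ms)"
proof -
  obtain ms' a where ms: "ms = ms' @ [a]" using assms(1) alt_word_nonempty rev_exhaust by blast
  obtain b ns' where ns: "ns = b # ns'" using assms(2) alt_word_nonempty neq_Nil_conv by metis
  show ?thesis unfolding ms ns word_mult_snoc_Cons
    by (auto simp: word_star_def word_mult_def sgn_minus)
qed

lemma word_mult_assoc:
  assumes "alt_word ls" "alt_word ms" "alt_word ns"
  shows "word_mult (word_mult ls ms) ns = word_mult ls (word_mult ms ns)"
proof -
  obtain ls' a where ls: "ls = ls' @ [a]" using assms(1) alt_word_nonempty rev_exhaust by blast
  obtain c ns' where ns: "ns = c # ns'" using assms(3) alt_word_nonempty neq_Nil_conv by metis
  obtain b ms' where ms: "ms = b # ms'" using assms(2) alt_word_nonempty neq_Nil_conv by metis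
  show ?thesis
  proof (cases ms' rule: rev_exhaust)
    case Nil
    have "sgn (a + b) = sgn b" if "sgn a = sgn b" using that by (rule sgn_add_same)
    moreover have "sgn (b + c) = sgn b" if "sgn b = sgn c" using that by (metis sgn_add_same)
    ultimately show ?thesis unfolding ls ms ns Nil by (auto simp: word_mult_def butlast_append)
  next
    case (snoc ms'' d)
    show ?thesis unfolding ls ms ns snoc by (auto simp: word_mult_def butlast_append)
  qed
qed


section \<open>The \<open>*\<close>-semigroup \<open>A\<close>\<close>

text \<open>The congruence of \<open>A\<^sub>c\<close> generated by collapsing an interior entry \<open>\<plusminus>1\<close>.
  It is a partial equivalence relation on integer lists, with domain the alternating words.\<close>

inductive word_cong :: "int list \<Rightarrow> int list \<Rightarrow> bool" where
  collapse: "\<lbrakk>alt_word (us @ [a, e, b] @ vs); e = 1 \<or> e = -1\<rbrakk>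
    \<Longrightarrow> word_cong (us @ [a, e, b] @ vs) (us @ [a + e + b] @ vs)"
| refl: "alt_word ns \<Longrightarrow> word_cong ns ns"
| sym: "word_cong ms ns \<Longrightarrow> word_cong ns ms"
| trans: "\<lbrakk>word_cong ls ms; word_cong ms ns\<rbrakk> \<Longrightarrow> word_cong ls ns"
| mult_left: "\<lbrakk>alt_word ls; word_cong ms ns\<rbrakk> \<Longrightarrow> word_cong (word_mult ls ms) (word_mult ls ns)"
| mult_right: "\<lbrakk>alt_word ls; word_cong ms ns\<rbrakk> \<Longrightarrow> word_cong (word_mult ms ls) (word_mult ns ls)"

lemma alt_word_collapse:
  assumes "alt_word (us @ [a, e, b] @ vs)" "e = 1 \<or> e = -1"
  shows "alt_word (us @ [a + e + b] @ vs)"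
proof -
  have w: "us = [] \<or> alt_word us \<and> last us * a < 0" "vs = [] \<or> alt_word vs \<and> b * hd vs < 0"
    and *: "a * e < 0" "e * b < 0"
    using assms(1) unfolding append_Cons append_Nil alt_word_decomp alt_word_Cons by auto
  have s: "sgn a = sgn (a + e + b)" "sgn b = sgn (a + e + b)" "a + e + b \<noteq> 0"
    using * assms(2) by (auto simp: sgn_if)
  have "last us * a < 0 \<longleftrightarrow> last us * (a + e + b) < 0" "b * hd vs < 0 \<longleftrightarrow> (a + e + b) * hd vs < 0"
    using mult_less_0_same_sgn s by blast+
  with w s(3) show ?thesis unfolding append_Cons append_Nil alt_word_decomp by blast
qed

lemma word_cong_alt_word: "word_cong ms ns \<Longrightarrow> alt_word ms \<and> alt_word ns"
proof (induction rule: word_cong.induct)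
  case (collapse us a e b vs)
  then show ?case using alt_word_collapse by blast
qed (auto intro: alt_word_mult)

lemma word_cong_mult:
  "\<lbrakk>word_cong ms ms'; word_cong ns ns'\<rbrakk> \<Longrightarrow> word_cong (word_mult ms ns) (word_mult ms' ns')"
  by (meson word_cong.mult_left word_cong.mult_right word_cong.trans word_cong_alt_word)

lemma word_cong_star: "word_cong ms ns \<Longrightarrow> word_cong (word_star ms) (word_star ns)"
proof (induction rule: word_cong.induct)
  case (collapse us a e b vs)
  then have "alt_word (word_star (us @ [a, e, b] @ vs))" by (simp only: alt_word_star)
  then have "alt_word (word_star vs @ [-b, -e, -a] @ word_star us)" by (simp add: word_star_def)
  then have "word_cong (word_star vs @ [-b, -e, -a] @ word_star us)
      (word_star vs @ [-b + -e + -a] @ word_star us)"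
    by (rule word_cong.collapse) (use collapse in auto)
  then show ?case by (simp add: word_star_def algebra_simps)
next
  case (refl ns)
  then show ?case by (simp add: word_cong.refl alt_word_star)
next
  case (sym ms ns)
  then show ?case by (blast intro: word_cong.sym)
next
  case (trans ls ms ns)
  then show ?case by (blast intro: word_cong.trans)
next
  case (mult_left ls ms ns)
  then have "alt_word ms" "alt_word ns" by (blast dest: word_cong_alt_word)+
  with mult_left show ?case
    by (simp add: word_star_mult word_cong.mult_right alt_word_star)
next
  case (mult_right ls ms ns)
  then have "alt_word ms" "alt_word ns" by (blast dest: word_cong_alt_word)+
  with mult_right show ?case
    by (simp add: word_star_mult word_cong.mult_left alt_word_star)
qed

lemma sum_list_word_mult:
  assumes "alt_word ms" "alt_word ns"
  shows "sum_list (word_mult ms ns) = sum_list ms + sum_list ns"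
proof -
  obtain ms' a where ms: "ms = ms' @ [a]" using assms(1) alt_word_nonempty rev_exhaust by blast
  obtain b ns' where ns: "ns = b # ns'" using assms(2) alt_word_nonempty neq_Nil_conv by metis
  show ?thesis unfolding ms ns word_mult_snoc_Cons by simp
qed

lemma word_cong_sum_list: "word_cong ms ns \<Longrightarrow> sum_list ms = sum_list ns"
proof (induction rule: word_cong.induct)
  case (mult_left ls ms ns)
  then show ?case using word_cong_alt_word[of ms ns] by (simp add: sum_list_word_mult)
next
  case (mult_right ls ms ns)
  then show ?case using word_cong_alt_word[of ms ns] by (simp add: sum_list_word_mult)
qed simp_all

quotient_type A = "int list" / partial: word_cong
proof (rule part_equivpI)
  show "\<exists>ns. word_cong ns ns"
    by (rule exI[of _ "[1]"], rule word_cong.refl) (simp add: alt_word_def)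
  show "symp word_cong" by (rule sympI) (rule word_cong.sym)
  show "transp word_cong" by (rule transpI) (rule word_cong.trans)
qed

text \<open>The class of a word; meaningful only for alternating words.\<close>

abbreviation cls :: "int list \<Rightarrow> A" where "cls \<equiv> abs_A"

instantiation A :: star_semigroup
begin

lift_definition times_A :: "A \<Rightarrow> A \<Rightarrow> A" is word_mult
  by (rule word_cong_mult)

lift_definition star_A :: "A \<Rightarrow> A" is word_star
  by (rule word_cong_star)

instance
proof
  fix a b c :: A
  show "a * b * c = a * (b * c)"
    by transfer (metis alt_word_mult word_cong.refl word_cong_alt_word word_mult_assoc)
  show "star (star a) = a"
    by transfer (simp add: word_star_star)
  show "star (a * b) = star b * star a"
    by transfer
      (metis alt_word_mult alt_word_star word_cong.refl word_cong_alt_word word_star_mult)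
qed

end

lemma cls_eq_iff: "\<lbrakk>alt_word ms; alt_word ns\<rbrakk> \<Longrightarrow> cls ms = cls ns \<longleftrightarrow> word_cong ms ns"
  by (meson Quotient3_A Quotient3_rel word_cong.refl)

lemma cls_mult: "\<lbrakk>alt_word ms; alt_word ns\<rbrakk> \<Longrightarrow> cls ms * cls ns = cls (word_mult ms ns)"
  by (simp add: times_A.abs_eq word_cong.refl)

lemma star_cls: "alt_word ns \<Longrightarrow> star (cls ns) = cls (word_star ns)"
  by (simp add: star_A.abs_eq word_cong.refl)

lift_definition tau :: "A \<Rightarrow> int" is sum_list
  by (rule word_cong_sum_list)

definition A0 :: "A set" where
  "A0 = {a. tau a = 0}"

definition reduced :: "int list \<Rightarrow> bool" where
  "reduced ns \<longleftrightarrow> alt_word ns \<and> (\<forall>j. 1 \<le> j \<and> j + 1 < length ns \<longrightarrow> ns ! j \<noteq> 1 \<and> ns ! j \<noteq> -1)"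

definition A_plus :: "A set" where
  "A_plus = {cls ns | ns. reduced ns \<and> length ns \<ge> 2 \<and> hd ns < 0 \<and> last ns > 0}"

definition Irr_plus_A0 :: "A set" where
  "Irr_plus_A0 = Irr A0 \<inter> A_plus"

definition D1 :: "A set" where
  "D1 = star_subsemigroup_gen (insert (cls [1, -1]) Irr_plus_A0)"

definition alpha :: "A \<Rightarrow> A" where
  "alpha n = cls [-1] * n * cls [1]"


section \<open>Matricial order\<close>

text \<open>The matrix \<open>[w\<^sub>i]\<^sup>*[w\<^sub>j]\<close> of a row \<open>[w\<^sub>i]\<close>. As \<open>A\<close> has no addition,
  it consists of single products.\<close>

definition gram :: "'a::star_semigroup vec \<Rightarrow> 'a mat" where
  "gram w = mat (dim_vec w) (dim_vec w) (\<lambda>(i, j). star (w $ i) * w $ j)"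

definition row_act :: "'a::semigroup_mult \<Rightarrow> 'a vec \<Rightarrow> 'a vec" where
  "row_act a w = map_vec (\<lambda>x. a * x) w"

definition matsA :: "nat \<Rightarrow> A mat set" where
  "matsA k = gram ` carrier_vec k"

inductive mat_le :: "nat \<Rightarrow> A mat \<Rightarrow> A mat \<Rightarrow> bool" for k where
  neg: "\<lbrakk>w \<in> carrier_vec k; u \<in> carrier_vec k; row_act (cls [-1, 1]) w = w; w = row_act (cls [-1]) u\<rbrakk>
    \<Longrightarrow> mat_le k (gram w) (gram u)"
| pos: "\<lbrakk>w \<in> carrier_vec k; u \<in> carrier_vec k; row_act (cls [1, -1]) w = w; w = row_act (cls [1]) u\<rbrakk>
    \<Longrightarrow> mat_le k (gram w) (gram u)"
| refl: "a \<in> matsA k \<Longrightarrow> mat_le k a a"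
| trans: "\<lbrakk>mat_le k a b; mat_le k b c\<rbrakk> \<Longrightarrow> mat_le k a c"

definition mats :: "A set \<Rightarrow> nat \<Rightarrow> A mat set" where
  "mats D k = {a \<in> matsA k. elements_mat a \<subseteq> D}"

text \<open>The restricted order: a chain of generating inequalities between two matrices over \<open>D\<close>
  may pass through matrices whose entries are not in \<open>D\<close>.\<close>

definition mats_le :: "A set \<Rightarrow> nat \<Rightarrow> A mat \<Rightarrow> A mat \<Rightarrow> bool" where
  "mats_le D k a b \<longleftrightarrow> a \<in> mats D k \<and> b \<in> mats D k \<and> mat_le k a b"

end

theory Submission
  imports Defs
begin

text \<open>
  Write \<open>t\<close> for the class of \<open>(1)\<close>, so that \<open>t\<^sup>*\<close> is the class of \<open>(-1)\<close> and
  \<open>\<alpha> n = t\<^sup>* n t\<close>. The order statements are formal. A generating inequality only constrains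
  multiplication of a row from the left, and \<open>\<alpha>\<close> sends the matrix of a row \<open>[w\<^sub>i]\<close> to that of
  \<open>[w\<^sub>i t]\<close>; hence \<open>\<alpha>\<close> carries generating inequalities to generating inequalities
  (\<open>alpha_mat_le\<close>). The Schwarz inequality is a single generating inequality, for the rows
  \<open>[t\<^sup>* n\<^sub>i t]\<close> and \<open>[n\<^sub>i t]\<close> (\<open>schwarz_mat_le\<close>).

  What needs work is that \<open>\<alpha>\<close> maps \<open>D\<^sub>1\<close> to itself. The defining relation of \<open>A\<close> amounts to
  \<open>t t\<^sup>* t = t\<close>, so an element of \<open>A\<close> is a word in \<open>t\<close> and \<open>t\<^sup>*\<close> up to this relation and its
  adjoint. Read the word as a walk on the integers with steps \<open>+1\<close> and \<open>-1\<close>, starting at \<open>0\<close>.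
  Replacing \<open>t t\<^sup>* t\<close> by \<open>t\<close> does not change the set of heights visited; in particular the
  highest point is an invariant, and so are the end point \<open>\<tau>\<close> and the first and the last step.

  Every element of \<open>D\<^sub>1\<close> has a walk from \<open>0\<close> to \<open>0\<close> that stays at or below \<open>1\<close> (\<open>D1_walk\<close>):
  if a walk beginning with a downward step visits \<open>1\<close>, cutting it just before its first arrival
  there is a proper factorization in \<open>A\<^sup>0\<close>, so its class is not irreducible. Passing from \<open>n\<close> to
  \<open>t\<^sup>* n t\<close> lowers the walk by \<open>1\<close>, so it then stays at or below \<open>0\<close>. Conversely, a walk from
  \<open>0\<close> to \<open>0\<close> staying at or below \<open>0\<close> can be cut at all its returns to \<open>0\<close>, and each
  excursion represents an element of \<open>Irr\<^sub>+(A\<^sup>0)\<close> (\<open>prime_walk_Irr_plus\<close>); so its class lies in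
  \<open>D\<^sub>1\<close> (\<open>nonpositive_walk_D1\<close>).
\<close>

section \<open>Walks\<close>

abbreviation letters :: "int list \<Rightarrow> bool" where
  "letters w \<equiv> set w \<subseteq> {1, -1}"

definition spell :: "int list \<Rightarrow> int list" where
  "spell ns = concat (map (\<lambda>n. replicate (nat \<bar>n\<bar>) (sgn n)) ns)"

text \<open>The value of the empty walk is left unspecified, since \<open>A\<close> has no unit.\<close>

fun val :: "int list \<Rightarrow> A" where
  "val [a] = cls [a]"
| "val (a # b # w) = cls [a] * val (b # w)"

lemma val_Cons: "w \<noteq> [] \<Longrightarrow> val (a # w) = cls [a] * val w"
  by (cases w) auto

lemma val_append: "\<lbrakk>u \<noteq> []; v \<noteq> []\<rbrakk> \<Longrightarrow> val (u @ v) = val u * val v"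
  by (induction u rule: list_nonempty_induct) (simp_all add: val_Cons mult.assoc)

lemma spell_append: "spell (ms @ ns) = spell ms @ spell ns"
  by (simp add: spell_def)

lemma letters_spell: "alt_word ns \<Longrightarrow> letters (spell ns)"
  by (auto simp: spell_def alt_word_def sgn_if)

lemma spell_nonempty: "alt_word ns \<Longrightarrow> spell ns \<noteq> []"
  by (auto simp: spell_def alt_word_def neq_Nil_conv)

lemma spell_word_mult:
  assumes "alt_word ms" "alt_word ns"
  shows "spell (word_mult ms ns) = spell ms @ spell ns"
proof -
  obtain ms' a where ms: "ms = ms' @ [a]" using assms(1) alt_word_nonempty rev_exhaust by blast
  obtain b ns' where ns: "ns = b # ns'" using assms(2) alt_word_nonempty neq_Nil_conv by metis
  have "replicate (nat \<bar>a + b\<bar>) (sgn (a + b)) =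
      replicate (nat \<bar>a\<bar>) (sgn a) @ replicate (nat \<bar>b\<bar>) (sgn b)" if s: "sgn a = sgn b"
  proof -
    have "nat \<bar>a + b\<bar> = nat \<bar>a\<bar> + nat \<bar>b\<bar>"
      using s by (auto simp: sgn_if split: if_splits)
    then show ?thesis using s by (simp add: sgn_add_same replicate_add)
  qed
  then show ?thesis unfolding ms ns word_mult_snoc_Cons
    by (simp add: spell_def)
qed

lemma hd_spell: "alt_word ns \<Longrightarrow> hd (spell ns) = sgn (hd ns)"
  by (cases ns) (auto simp: spell_def alt_word_def hd_append)

lemma last_spell: "alt_word ns \<Longrightarrow> last (spell ns) = sgn (last ns)"
  by (cases ns rule: rev_cases) (auto simp: spell_def alt_word_def last_append)

lemma alt_word_singleton: "alt_word [a] \<longleftrightarrow> a \<noteq> 0"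
  by (auto simp: alt_word_def)

text \<open>Adding up runs of equal letters inverts \<open>spell\<close>. Together with \<open>val_spell\<close> this allows
  computing in \<open>A\<close> with walks instead of alternating words.\<close>

lemma ex_alt_word_of_walk:
  assumes "w \<noteq> []" "letters w"
  shows "\<exists>ns. alt_word ns \<and> spell ns = w \<and> cls ns = val w"
  using assms
proof (induction w rule: list_nonempty_induct)
  case (single a)
  then have "alt_word [a] \<and> spell [a] = [a] \<and> cls [a] = val [a]"
    by (auto simp: alt_word_singleton spell_def)
  then show ?case by blast
next
  case (cons a w)
  then obtain ns where ns: "alt_word ns" "spell ns = w" "cls ns = val w" by auto
  have a: "alt_word [a]" "spell [a] = [a]"
    using cons.prems by (auto simp: alt_word_singleton spell_def)
  have "spell (word_mult [a] ns) = a # w" using spell_word_mult[OF a(1) ns(1)] a ns by simp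
  moreover have "cls (word_mult [a] ns) = val (a # w)"
    using cls_mult[OF a(1) ns(1)] ns cons.hyps by (simp add: val_Cons)
  ultimately show ?case using alt_word_mult[OF a(1) ns(1)] by blast
qed

lemma val_replicate:
  "e = 1 \<or> e = -1 \<Longrightarrow> val (replicate (Suc n) e) = cls [of_nat (Suc n) * e]"
proof (induction n)
  case (Suc n)
  have "val (replicate (Suc (Suc n)) e) = cls [e] * cls [of_nat (Suc n) * e]"
    using Suc by (simp add: val_Cons)
  also have "\<dots> = cls (word_mult [e] [of_nat (Suc n) * e])"
    using Suc.prems by (intro cls_mult) (auto simp: alt_word_singleton)
  also have "word_mult [e] [of_nat (Suc n) * e] = [of_nat (Suc (Suc n)) * e]"
    using Suc.prems by (auto simp: word_mult_def sgn_if algebra_simps)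
  finally show ?case .
qed simp

lemma val_spell_singleton: "a \<noteq> 0 \<Longrightarrow> val (spell [a]) = cls [a]"
proof -
  assume a: "a \<noteq> 0"
  then obtain n where n: "nat \<bar>a\<bar> = Suc n" by (metis not0_implies_Suc zero_less_abs_iff zero_less_nat_eq less_irrefl)
  have "of_nat (Suc n) * sgn a = a" using a n by (auto simp: sgn_if split: if_splits)
  moreover have "sgn a = 1 \<or> sgn a = -1" using a by (auto simp: sgn_if)
  ultimately show ?thesis using val_replicate[of "sgn a" n] n by (simp add: spell_def)
qed

lemma val_spell: "alt_word ns \<Longrightarrow> val (spell ns) = cls ns"
proof (induction ns)
  case (Cons a ns)
  show ?case
  proof (cases "ns = []")
    case True
    then show ?thesis using Cons.prems by (simp add: alt_word_singleton val_spell_singleton)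
  next
    case False
    then have a: "alt_word [a]" "alt_word ns" "a * hd ns < 0"
      using Cons.prems unfolding alt_word_Cons by (auto simp: alt_word_singleton)
    have "sgn a \<noteq> sgn (hd ns)" using a(3) by (auto simp: mult_less_0_iff)
    then have "word_mult [a] ns = a # ns" using False by (simp add: word_mult_def)
    then have "cls (a # ns) = cls [a] * cls ns" using cls_mult[OF a(1,2)] by simp
    also have "\<dots> = val (spell [a]) * val (spell ns)"
      using a Cons.IH by (simp add: alt_word_singleton val_spell_singleton)
    also have "\<dots> = val (spell [a] @ spell ns)"
      using a spell_nonempty by (intro val_append[symmetric]) blast+
    also have "spell [a] @ spell ns = spell (a # ns)" by (simp add: spell_def)
    finally show ?thesis by simp
  qed
qed (simp add: alt_word_def)

lemma A_cases: obtains ns where "alt_word ns" "a = cls ns"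
  by (metis Quotient3_A Quotient3_def word_cong_alt_word)

lemma A_walk: obtains w where "w \<noteq> []" "letters w" "a = val w"
  by (metis A_cases letters_spell spell_nonempty val_spell)

lemma tau_val: "\<lbrakk>w \<noteq> []; letters w\<rbrakk> \<Longrightarrow> tau (val w) = sum_list w"
proof -
  assume w: "w \<noteq> []" "letters w"
  then obtain ns where ns: "alt_word ns" "spell ns = w" "cls ns = val w"
    using ex_alt_word_of_walk by blast
  have "tau (cls ns) = sum_list ns" using ns(1) by (simp add: tau.abs_eq word_cong.refl)
  moreover have "sum_list (spell ns) = sum_list ns"
    by (induction ns) (auto simp: spell_def sum_list_replicate abs_mult_sgn mult.commute)
  ultimately show ?thesis using ns by simp
qed

lemma letter_partial_isometry: "e = 1 \<or> e = -1 \<Longrightarrow> cls [e] * cls [-e] * cls [e] = cls [e]"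
proof -
  assume e: "e = 1 \<or> e = -1"
  then have "word_cong ([] @ [e, -e, e] @ []) ([] @ [e + -e + e] @ [])"
    by (intro word_cong.collapse) (auto simp: alt_word_def)
  then have "cls [e, -e, e] = cls [e]"
    by (subst cls_eq_iff) (use e in \<open>auto simp: alt_word_def\<close>)
  moreover have "cls [e] * cls [-e] = cls [e, -e]"
    using e by (subst cls_mult) (auto simp: alt_word_def word_mult_def)
  moreover have "cls [e, -e] * cls [e] = cls [e, -e, e]"
    using e by (subst cls_mult) (auto simp: alt_word_def word_mult_def)
  ultimately show ?thesis by simp
qed

lemma star_letter: "star (cls [1]) = cls [-1]" "star (cls [-1]) = cls [1]"
  by (simp_all add: star_cls alt_word_singleton word_star_def)

lemma star_val: "\<lbrakk>w \<noteq> []; letters w\<rbrakk> \<Longrightarrow> star (val w) = val (rev (map uminus w))"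
proof (induction w rule: list_nonempty_induct)
  case (single a)
  then show ?case by (auto simp: star_letter)
next
  case (cons a w)
  then show ?case by (auto simp: val_Cons star_mult star_letter val_append)
qed


section \<open>Invariants of the defining relation\<close>

text \<open>Collapsing an interior entry \<open>\<plusminus>1\<close> is, on walks, the replacement of one factor
  \<open>t t\<^sup>* t\<close> by \<open>t\<close>, or of its adjoint: the two neighbouring entries lose one letter between
  them besides the collapsed one.\<close>

lemma spell_collapse:
  assumes "alt_word [a, e, b]" "e = 1 \<or> e = -1"
  shows "\<exists>x y. spell [a, e, b] = x @ [-e, e, -e] @ y \<and> spell [a + e + b] = x @ [-e] @ y"
proof -
  have ab: "a * e < 0" "e * b < 0" using assms(1) by (auto simp: alt_word_def)
  then have s: "sgn a = -e" "sgn b = -e" "sgn (a + e + b) = -e" "sgn e = e" "nat \<bar>e\<bar> = 1"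
    using assms(2) by (auto simp: sgn_if mult_less_0_iff)
  define j k where "j = nat \<bar>a\<bar> - 1" and "k = nat \<bar>b\<bar> - 1"
  have n: "nat \<bar>a\<bar> = j + 1" "nat \<bar>b\<bar> = 1 + k" "nat \<bar>a + e + b\<bar> = j + 1 + k"
    using ab assms(2) by (auto simp: j_def k_def mult_less_0_iff)
  have "spell [a, e, b] = replicate j (-e) @ [-e, e, -e] @ replicate k (-e)"
    unfolding spell_def by (simp add: s n replicate_append_same)
  moreover have "spell [a + e + b] = replicate j (-e) @ [-e] @ replicate k (-e)"
    unfolding spell_def by (simp add: s n replicate_add replicate_append_same)
  ultimately show ?thesis by blast
qed

text \<open>The contexts \<open>p\<close> and \<open>q\<close> carry the induction through the closure of the congruence under
  multiplication.\<close>

lemma word_cong_invariant: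
  assumes inv: "\<And>x e y. e = 1 \<or> e = -1 \<Longrightarrow> f (x @ [e, -e, e] @ y) = f (x @ [e] @ y)"
    and "word_cong ms ns"
  shows "f (p @ spell ms @ q) = f (p @ spell ns @ q)"
  using assms(2)
proof (induction arbitrary: p q rule: word_cong.induct)
  case (collapse us a e b vs)
  have "alt_word [a, e, b]"
    using collapse by (auto simp: alt_word_def successively_append_iff)
  then obtain x y where xy: "spell [a, e, b] = x @ [-e, e, -e] @ y" "spell [a + e + b] = x @ [-e] @ y"
    using spell_collapse collapse by blast
  have "f ((p @ spell us @ x) @ [-e, - (-e), -e] @ (y @ spell vs @ q)) =
      f ((p @ spell us @ x) @ [-e] @ (y @ spell vs @ q))"
    using collapse by (intro inv) auto
  then show ?case unfolding spell_append xy by simp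
next
  case (mult_left ls ms ns)
  then have "alt_word ms" "alt_word ns" by (blast dest: word_cong_alt_word)+
  then show ?case using mult_left.IH[of "p @ spell ls" q] mult_left.hyps
    by (simp add: spell_word_mult)
next
  case (mult_right ls ms ns)
  then have "alt_word ms" "alt_word ns" by (blast dest: word_cong_alt_word)+
  then show ?case using mult_right.IH[of p "spell ls @ q"] mult_right.hyps
    by (simp add: spell_word_mult)
qed auto

lemma val_invariant:
  assumes inv: "\<And>x e y. e = 1 \<or> e = -1 \<Longrightarrow> f (x @ [e, -e, e] @ y) = f (x @ [e] @ y)"
    and "v \<noteq> []" "letters v" "w \<noteq> []" "letters w" "val v = val w"
  shows "f v = f w"
proof -
  obtain ms where ms: "alt_word ms" "spell ms = v" "cls ms = val v"
    using ex_alt_word_of_walk assms(2,3) by blast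
  obtain ns where ns: "alt_word ns" "spell ns = w" "cls ns = val w"
    using ex_alt_word_of_walk assms(4,5) by blast
  have "word_cong ms ns" using ms ns assms(6) cls_eq_iff by metis
  then show ?thesis
    using word_cong_invariant[of f ms ns "[]" "[]", OF inv] ms ns by simp
qed

primrec peak :: "int list \<Rightarrow> int" where
  "peak [] = 0"
| "peak (a # w) = max 0 (a + peak w)"

primrec trough :: "int list \<Rightarrow> int" where
  "trough [] = 0"
| "trough (a # w) = min 0 (a + trough w)"

lemma peak_nonneg: "peak w \<ge> 0"
  by (cases w) auto

lemma trough_nonpos: "trough w \<le> 0"
  by (cases w) auto

lemma peak_append: "peak (u @ v) = max (peak u) (sum_list u + peak v)"
  by (induction u) (auto simp: peak_nonneg)

lemma trough_append: "trough (u @ v) = min (trough u) (sum_list u + trough v)"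
  by (induction u) (auto simp: trough_nonpos)

text \<open>The adjoint traverses the walk backwards, with heights measured from the end point.\<close>

lemma peak_reverse: "peak (rev (map uminus w)) = peak w - sum_list w"
proof (induction w)
  case (Cons a w)
  have "sum_list (rev (map uminus w)) = - sum_list w" by (induction w) auto
  then show ?case using Cons peak_nonneg[of w] by (auto simp: peak_append)
qed simp

text \<open>A walk with a deep split returns to \<open>0\<close> between two descents to \<open>-2\<close>. Returning to \<open>0\<close> is
  not by itself an invariant notion: \<open>t\<^sup>* t\<close> equals \<open>t\<^sup>* t t\<^sup>* t\<close>. Such spurious returns come
  from replacing \<open>t\<close> by \<open>t t\<^sup>* t\<close>, and near \<open>0\<close> these oscillations do not reach \<open>-2\<close>.\<close>

definition deep_split :: "int list \<Rightarrow> bool" where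
  "deep_split w \<longleftrightarrow> (\<exists>u v. w = u @ v \<and> sum_list u = 0 \<and> trough u \<le> -2 \<and> trough v \<le> -2)"

lemma peak_collapse: "e = 1 \<or> e = -1 \<Longrightarrow> peak (x @ [e, -e, e] @ y) = peak (x @ [e] @ y)"
  using peak_nonneg[of y] by (auto simp: peak_append)

lemma trough_collapse: "e = 1 \<or> e = -1 \<Longrightarrow> trough (x @ [e, -e, e] @ y) = trough (x @ [e] @ y)"
  using trough_nonpos[of y] by (auto simp: trough_append)

text \<open>A cut inside the factor \<open>[e, -e, e]\<close> is moved to the point of the same height at an end of
  \<open>[e]\<close>. If that height is \<open>0\<close>, the part of the walk transferred from one side to the other
  stays between \<open>-1\<close> and \<open>1\<close>, so it cannot affect whether a side reaches \<open>-2\<close>.\<close>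

lemma deep_split_collapse:
  assumes e: "e = 1 \<or> e = -1"
  shows "deep_split (x @ [e, -e, e] @ y) = deep_split (x @ [e] @ y)"
proof
  assume "deep_split (x @ [e, -e, e] @ y)"
  then obtain u v where uv: "x @ [e, -e, e] @ y = u @ v"
    and d: "sum_list u = 0" "trough u \<le> -2" "trough v \<le> -2"
    unfolding deep_split_def by blast
  from uv consider (left) z where "x = u @ z" "v = z @ [e, -e, e] @ y"
    | (first) "u = x @ [e]" "v = [-e, e] @ y"
    | (second) "u = x @ [e, -e]" "v = [e] @ y"
    | (right) z where "u = x @ [e, -e, e] @ z" "y = z @ v"
    by (auto simp: append_eq_append_conv2 append_eq_Cons_conv Cons_eq_append_conv)
  then show "deep_split (x @ [e] @ y)"
  proof cases
    case left
    then show ?thesis using d trough_collapse[OF e, of z y] unfolding deep_split_def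
      by (intro exI[of _ u] exI[of _ "z @ [e] @ y"]) auto
  next
    case first
    then show ?thesis using d e trough_nonpos[of y] unfolding deep_split_def
      by (intro exI[of _ "x @ [e]"] exI[of _ y]) auto
  next
    case second
    then show ?thesis using d e trough_nonpos[of x] unfolding deep_split_def
      by (intro exI[of _ x] exI[of _ "[e] @ y"]) (auto simp: trough_append)
  next
    case right
    then show ?thesis using d trough_collapse[OF e, of x z] unfolding deep_split_def
      by (intro exI[of _ "x @ [e] @ z"] exI[of _ v]) auto
  qed
next
  assume "deep_split (x @ [e] @ y)"
  then obtain u v where uv: "x @ [e] @ y = u @ v"
    and d: "sum_list u = 0" "trough u \<le> -2" "trough v \<le> -2"
    unfolding deep_split_def by blast
  from uv consider (left) z where "x = u @ z" "v = z @ [e] @ y"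
    | (right) z where "u = x @ [e] @ z" "y = z @ v"
    by (auto simp: append_eq_append_conv2 append_eq_Cons_conv Cons_eq_append_conv)
  then show "deep_split (x @ [e, -e, e] @ y)"
  proof cases
    case left
    then show ?thesis using d trough_collapse[OF e, of z y] unfolding deep_split_def
      by (intro exI[of _ u] exI[of _ "z @ [e, -e, e] @ y"]) auto
  next
    case right
    then show ?thesis using d trough_collapse[OF e, of x z] unfolding deep_split_def
      by (intro exI[of _ "x @ [e, -e, e] @ z"] exI[of _ v]) auto
  qed
qed

lemmas peak_invariant = val_invariant[of peak, OF peak_collapse]
lemmas deep_split_invariant = val_invariant[of deep_split, OF deep_split_collapse]

lemma hd_invariant:
  assumes "v \<noteq> []" "letters v" "w \<noteq> []" "letters w" "val v = val w"
  shows "hd v = hd w"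
  using assms by (rule val_invariant[of hd, rotated]) (auto simp: hd_append)

lemma last_invariant:
  assumes "v \<noteq> []" "letters v" "w \<noteq> []" "letters w" "val v = val w"
  shows "last v = last w"
  using assms by (rule val_invariant[of last, rotated]) (auto simp: last_append)


section \<open>Walks of elements of \<open>D\<^sub>1\<close>\<close>

lemma split_at_ascent:
  assumes "letters w" "peak w \<ge> 1"
  shows "\<exists>u v. w = u @ 1 # v \<and> sum_list u = 0 \<and> peak u = 0"
  using assms
proof (induction w rule: rev_induct)
  case (snoc a w)
  show ?case
  proof (cases "peak w \<ge> 1")
    case True
    then obtain u v where "w = u @ 1 # v" "sum_list u = 0" "peak u = 0" using snoc by auto
    then show ?thesis by (intro exI[of _ u] exI[of _ "v @ [a]"]) simp
  next
    case False
    then have "peak w = 0" using peak_nonneg[of w] by simp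
    moreover have "sum_list w \<le> peak w" using peak_append[of w "[]"] by simp
    ultimately have "a = 1" "sum_list w = 0"
      using snoc.prems by (auto simp: peak_append)
    then show ?thesis using \<open>peak w = 0\<close> by (intro exI[of _ w] exI[of _ "[]"]) simp
  qed
qed simp

text \<open>A walk of \<open>p\<close> that rises above \<open>0\<close> is cut where it first leaves \<open>0\<close> towards \<open>1\<close>. The left
  factor differs from \<open>p\<close> because it does not rise above \<open>0\<close>, the right one because it begins
  with an upward step.\<close>

lemma Irr_plus_walk:
  assumes "p \<in> Irr_plus_A0"
  shows "\<exists>w. w \<noteq> [] \<and> letters w \<and> p = val w \<and> sum_list w = 0 \<and> peak w = 0"
proof -
  obtain ns where ns: "p = cls ns" "reduced ns" "hd ns < 0"
    using assms by (auto simp: Irr_plus_A0_def A_plus_def)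
  define w where "w = spell ns"
  have alt: "alt_word ns" using ns by (simp add: reduced_def)
  have w: "w \<noteq> []" "letters w" "p = val w" "hd w = -1"
    using ns alt by (simp_all add: w_def spell_nonempty letters_spell val_spell hd_spell)
  have irr: "p \<in> A0" "\<And>m n. \<lbrakk>m \<in> A0; n \<in> A0; p = m * n\<rbrakk> \<Longrightarrow> p = m \<or> p = n"
    using assms by (auto simp: Irr_plus_A0_def Irr_def)
  have sum: "sum_list w = 0" using irr(1) w by (simp add: A0_def tau_val)
  have "peak w = 0"
  proof (rule ccontr)
    assume "peak w \<noteq> 0"
    then have pk: "peak w \<ge> 1" using peak_nonneg[of w] by simp
    then obtain u v where uv: "w = u @ 1 # v" "sum_list u = 0" "peak u = 0"
      using split_at_ascent w by blast
    have u: "u \<noteq> []" "letters u" "letters (1 # v)" using uv w by auto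
    have "val u \<in> A0" "val (1 # v) \<in> A0" "p = val u * val (1 # v)"
      using u uv sum w by (auto simp: A0_def tau_val val_append)
    then have "p = val u \<or> p = val (1 # v)" by (intro irr(2))
    then have "val w = val u \<or> val w = val (1 # v)" unfolding w(3) .
    moreover have "val w \<noteq> val u"
    proof
      assume "val w = val u"
      then have "peak w = peak u" by (intro peak_invariant w u)
      then show False using pk uv(3) by linarith
    qed
    moreover have "val w \<noteq> val (1 # v)"
    proof
      assume "val w = val (1 # v)"
      then have "hd w = hd (1 # v)" by (intro hd_invariant w u) simp
      then show False using w(4) by simp
    qed
    ultimately show False by iprover
  qed
  then show ?thesis using w sum by blast
qed

lemma D1_walk:
  assumes "a \<in> D1"
  shows "\<exists>w. w \<noteq> [] \<and> letters w \<and> a = val w \<and> sum_list w = 0 \<and> peak w \<le> 1"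
  using assms unfolding D1_def
proof (induction rule: star_subsemigroup_gen.induct)
  case (gen a)
  show ?case
  proof (cases "a = cls [1, -1]")
    case True
    have "a = val [1, -1]"
      by (simp add: True cls_mult alt_word_singleton word_mult_def)
    then show ?thesis by (intro exI[of _ "[1, -1]"]) simp
  next
    case False
    then obtain w where "w \<noteq> []" "letters w" "a = val w" "sum_list w = 0" "peak w = 0"
      using gen Irr_plus_walk by blast
    then show ?thesis by (intro exI[of _ w]) simp
  qed
next
  case (mult a b)
  from mult.IH(1) obtain u where u: "u \<noteq> []" "letters u" "a = val u" "sum_list u = 0" "peak u \<le> 1"
    by (elim exE conjE)
  from mult.IH(2) obtain v where v: "v \<noteq> []" "letters v" "b = val v" "sum_list v = 0" "peak v \<le> 1"
    by (elim exE conjE)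
  have "peak (u @ v) \<le> 1" using u v by (simp add: peak_append)
  then show ?case using u v by (intro exI[of _ "u @ v"]) (simp add: val_append)
next
  case (star a)
  from star.IH obtain w where w: "w \<noteq> []" "letters w" "a = val w" "sum_list w = 0" "peak w \<le> 1"
    by (elim exE conjE)
  let ?w' = "rev (map uminus w)"
  have "sum_list ?w' = - sum_list w" by (induction w) auto
  then have "sum_list ?w' = 0" using w(4) by simp
  moreover have "letters ?w'" using w(2) by auto
  moreover have "peak ?w' \<le> 1" using w(4,5) by (simp add: peak_reverse)
  moreover have "star a = val ?w'" using star_val[OF w(1,2)] w(3) by simp
  moreover have "?w' \<noteq> []" using w(1) by simp
  ultimately show ?case by (intro exI[of _ ?w'] conjI)
qed

text \<open>Such a walk is a power of the projection \<open>t\<^sup>* t\<close>.\<close>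

lemma val_shallow_walk:
  assumes "w \<noteq> []" "letters w" "sum_list w = 0" "peak w = 0" "trough w \<ge> -1"
  shows "val w = cls [-1] * cls [1]"
  using assms
proof (induction "length w" arbitrary: w rule: less_induct)
  case less
  obtain a w' where w: "w = a # w'" using less.prems(1) by (cases w) auto
  then have a: "a = -1" using less.prems(2,4) peak_nonneg[of w'] by auto
  then obtain b v where w': "w' = b # v" using less.prems(3) w by (cases w') auto
  have b: "b = 1" using less.prems(2,5) w w' a trough_nonpos[of v] by auto
  show ?case
  proof (cases "v = []")
    case True
    then show ?thesis by (simp add: w w' a b)
  next
    case False
    have "val v = cls [-1] * cls [1]"
      using less.prems False peak_nonneg[of v] trough_nonpos[of v]
      by (intro less.hyps) (auto simp: w w' a b)
    then have "val w = (cls [-1] * cls [1] * cls [-1]) * cls [1]"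
      using False by (simp add: w w' a b val_Cons mult.assoc)
    then show ?thesis using letter_partial_isometry[of "-1"] by simp
  qed
qed

lemma val_absorb_left:
  assumes "hd w = -1" "w \<noteq> []"
  shows "cls [-1] * cls [1] * val w = val w"
proof -
  obtain v where w: "w = -1 # v" using assms by (cases w) auto
  show ?thesis using letter_partial_isometry[of "-1"] by (cases "v = []") (simp_all add: w val_Cons flip: mult.assoc)
qed

lemma val_absorb_right:
  assumes "last w = 1" "w \<noteq> []"
  shows "val w * (cls [-1] * cls [1]) = val w"
proof -
  obtain v where w: "w = v @ [1]" using assms by (cases w rule: rev_cases) auto
  show ?thesis using letter_partial_isometry[of 1]
    by (cases "v = []") (simp_all add: w val_append mult.assoc)
qed

lemma hd_peak_0:
  assumes "w \<noteq> []" "letters w" "peak w = 0"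
  shows "hd w = -1"
proof -
  obtain a v where w: "w = a # v" using assms(1) by (cases w) auto
  show ?thesis using assms peak_nonneg[of v] unfolding w by auto
qed

lemma last_peak_0:
  assumes "w \<noteq> []" "letters w" "peak w = 0" "sum_list w = 0"
  shows "last w = 1"
proof -
  obtain v a where w: "w = v @ [a]" using assms(1) by (cases w rule: rev_cases) auto
  show ?thesis using assms unfolding w by (auto simp: peak_append)
qed

text \<open>Each collapse shortens the word by two entries.\<close>

lemma ex_reduced: "alt_word ns \<Longrightarrow> \<exists>ms. reduced ms \<and> cls ms = cls ns"
proof (induction "length ns" arbitrary: ns rule: less_induct)
  case less
  show ?case
  proof (cases "reduced ns")
    case False
    then obtain j where j: "1 \<le> j" "j + 1 < length ns" "ns ! j = 1 \<or> ns ! j = -1"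
      using less.prems by (auto simp: reduced_def)
    define us a b vs where "us = take (j - 1) ns" and "a = ns ! (j - 1)"
      and "b = ns ! (j + 1)" and "vs = drop (j + 2) ns"
    then have ns: "ns = us @ [a, ns ! j, b] @ vs"
      using j id_take_nth_drop[of "j - 1" ns] Cons_nth_drop_Suc[of j ns]
        Cons_nth_drop_Suc[of "j + 1" ns] by simp
    then obtain e where e: "ns = us @ [a, e, b] @ vs" "e = 1 \<or> e = -1" using j(3) by blast
    define ms where "ms = us @ [a + e + b] @ vs"
    have "word_cong ns ms"
      using word_cong.collapse[of us a e b vs] less.prems e unfolding ms_def by simp
    then have ms: "alt_word ms" "cls ms = cls ns"
      using word_cong_alt_word[of ns ms] cls_eq_iff[of ns ms] by auto
    have "length ms < length ns" using e by (simp add: ms_def)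
    then show ?thesis using less.hyps[of ms] ms by simp
  next
    case True
    then show ?thesis by blast
  qed
qed

text \<open>In any factorization \<open>m n\<close> inside \<open>A\<^sup>0\<close>, neither factor rises above \<open>0\<close>, since the peak is
  an invariant. An excursion has no deep split, hence one of the factors stays in
  \<open>{-1, 0}\<close>. That factor is \<open>t\<^sup>* t\<close>, which acts trivially on the other one: the left factor is
  absorbed because \<open>n\<close> begins with \<open>t\<^sup>*\<close>, the right factor because \<open>m\<close> ends with \<open>t\<close>.\<close>

lemma prime_walk_Irr_plus:
  assumes w: "w \<noteq> []" "letters w" "sum_list w = 0" "peak w = 0"
    and prime: "\<And>u v. \<lbrakk>w = u @ v; u \<noteq> []; v \<noteq> []\<rbrakk> \<Longrightarrow> sum_list u \<noteq> 0"
  shows "val w \<in> Irr_plus_A0"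
proof -
  \<comment> \<open>The empty walk does not reach \<open>-2\<close>, so a deep split would be a proper cut at height \<open>0\<close>.\<close>
  have "\<not> deep_split w"
  proof
    assume "deep_split w"
    then obtain u v where "w = u @ v" "sum_list u = 0" "trough u \<le> -2" "trough v \<le> -2"
      unfolding deep_split_def by blast
    then show False using prime[of u v] by (cases "u = []"; cases "v = []") auto
  qed
  have "val w = m \<or> val w = n" if mn: "m \<in> A0" "n \<in> A0" "val w = m * n" for m n
  proof -
    obtain x where x: "x \<noteq> []" "letters x" "m = val x" by (rule A_walk)
    obtain y where y: "y \<noteq> []" "letters y" "n = val y" by (rule A_walk)
    have sums: "sum_list x = 0" "sum_list y = 0" using mn x y by (auto simp: A0_def tau_val)
    have eq: "val w = val (x @ y)" using mn x y by (simp add: val_append)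
    then have "peak (x @ y) = 0" using peak_invariant[of w "x @ y"] w x y by simp
    then have peaks: "peak x = 0" "peak y = 0"
      using sums peak_nonneg[of x] peak_nonneg[of y] by (auto simp: peak_append)
    have "\<not> deep_split (x @ y)"
      using deep_split_invariant[of w "x @ y"] eq w x y \<open>\<not> deep_split w\<close> by simp
    then have "\<not> (trough x \<le> -2 \<and> trough y \<le> -2)"
      using sums(1) unfolding deep_split_def by blast
    then have "trough x \<ge> -1 \<or> trough y \<ge> -1" by linarith
    then show ?thesis
    proof
      assume "trough x \<ge> -1"
      then have "m = cls [-1] * cls [1]" using val_shallow_walk x sums peaks by simp
      then show ?thesis using mn y val_absorb_left[of y] hd_peak_0 peaks by simp
    next
      assume "trough y \<ge> -1"
      then have "n = cls [-1] * cls [1]" using val_shallow_walk y sums peaks by simp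
      then show ?thesis using mn x val_absorb_right[of x] last_peak_0 peaks sums by simp
    qed
  qed
  moreover have "val w \<in> A0" using w by (simp add: A0_def tau_val)
  ultimately have irr: "val w \<in> Irr A0" by (auto simp: Irr_def)
  obtain ns where ns: "reduced ns" "cls ns = val w"
  proof -
    obtain ms where "alt_word ms" "cls ms = val w" using ex_alt_word_of_walk[OF w(1,2)] by (elim exE conjE)
    then show thesis using that ex_reduced[of ms] by auto
  qed
  then have alt: "alt_word ns" by (simp add: reduced_def)
  have "hd (spell ns) = hd w" "last (spell ns) = last w"
    using hd_invariant[of "spell ns" w] last_invariant[of "spell ns" w] ns alt w
    by (simp_all add: val_spell spell_nonempty letters_spell)
  then have sg: "hd ns < 0" "last ns > 0"
    using alt hd_peak_0[of w] last_peak_0[of w] w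
    by (simp_all add: hd_spell last_spell sgn_1_neg sgn_1_pos)
  then have "length ns \<ge> 2"
    using alt_word_nonempty[OF alt] by (cases ns; cases "tl ns") auto
  then have "val w \<in> A_plus"
    unfolding A_plus_def using ns sg by (intro CollectI exI[of _ ns]) simp
  with irr show ?thesis by (simp add: Irr_plus_A0_def)
qed

lemma nonpositive_walk_D1:
  assumes "w \<noteq> []" "letters w" "sum_list w = 0" "peak w = 0"
  shows "val w \<in> D1"
  using assms
proof (induction "length w" arbitrary: w rule: less_induct)
  case less
  show ?case
  proof (cases "\<exists>u v. w = u @ v \<and> u \<noteq> [] \<and> v \<noteq> [] \<and> sum_list u = 0")
    case True
    then obtain u v where uv: "w = u @ v" "u \<noteq> []" "v \<noteq> []" "sum_list u = 0" by blast
    then have "val u \<in> D1" "val v \<in> D1"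
      using less.prems peak_nonneg[of u] peak_nonneg[of v]
      by (auto intro!: less.hyps simp: peak_append)
    then show ?thesis unfolding D1_def uv(1) val_append[OF uv(2,3)]
      by (rule star_subsemigroup_gen.mult)
  next
    case False
    then have "val w \<in> Irr_plus_A0" using less.prems by (intro prime_walk_Irr_plus) auto
    then show ?thesis unfolding D1_def by (intro star_subsemigroup_gen.gen) simp
  qed
qed

text \<open>The initial \<open>t\<^sup>*\<close> lowers a walk bounded by \<open>1\<close> to one bounded by \<open>0\<close>.\<close>

lemma alpha_D1: "n \<in> D1 \<Longrightarrow> alpha n \<in> D1"
proof -
  assume "n \<in> D1"
  then obtain w where w: "w \<noteq> []" "letters w" "n = val w" "sum_list w = 0" "peak w \<le> 1"
    using D1_walk by blast
  have "alpha n = val (-1 # w @ [1])"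
    using w by (simp add: alpha_def val_Cons val_append mult.assoc)
  also have "\<dots> \<in> D1"
    using w by (intro nonpositive_walk_D1) (auto simp: peak_append)
  finally show ?thesis .
qed


section \<open>The matricial order\<close>

lemma alpha_star: "alpha (star n) = star (alpha n)"
  by (simp add: alpha_def star_mult star_letter mult.assoc)

lemma D1_mult: "\<lbrakk>a \<in> D1; b \<in> D1\<rbrakk> \<Longrightarrow> a * b \<in> D1"
  unfolding D1_def by (rule star_subsemigroup_gen.mult)

lemma D1_star: "a \<in> D1 \<Longrightarrow> star a \<in> D1"
  unfolding D1_def by (rule star_subsemigroup_gen.star)

text \<open>As \<open>\<alpha> (w\<^sub>i\<^sup>* w\<^sub>j) = (w\<^sub>i t)\<^sup>* (w\<^sub>j t)\<close>, applying \<open>\<alpha>\<close> entrywise amounts to multiplying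
  the row by \<open>t\<close> from the right.\<close>

lemma alpha_gram: "map_mat alpha (gram w) = gram (map_vec (\<lambda>x. x * cls [1]) w)"
  by (rule eq_matI) (auto simp: gram_def alpha_def star_mult star_letter mult.assoc)

lemma row_act_right: "map_vec (\<lambda>x. x * b) (row_act a w) = row_act a (map_vec (\<lambda>x. x * b) w)"
  by (rule eq_vecI) (auto simp: row_act_def mult.assoc)

lemma alpha_matsA: "a \<in> matsA k \<Longrightarrow> map_mat alpha a \<in> matsA k"
  by (auto simp: matsA_def alpha_gram)

text \<open>Right multiplication by \<open>t\<close> commutes with the left actions in the two generating rules,
  so it maps a chain of generating inequalities to such a chain.\<close>

lemma alpha_mat_le: "mat_le k a b \<Longrightarrow> mat_le k (map_mat alpha a) (map_mat alpha b)"
proof (induction rule: mat_le.induct)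
  case (neg w u)
  then show ?case unfolding alpha_gram
    by (intro mat_le.neg) (simp_all flip: row_act_right)
next
  case (pos w u)
  then show ?case unfolding alpha_gram
    by (intro mat_le.pos) (simp_all flip: row_act_right)
next
  case (refl a)
  then show ?case by (simp add: mat_le.refl alpha_matsA)
next
  case (trans a b c)
  then show ?case by (blast intro: mat_le.trans)
qed

lemma alpha_mats:
  assumes "a \<in> mats D1 k"
  shows "map_mat alpha a \<in> mats D1 k"
proof -
  have "x \<in> D1" if x: "x \<in> elements_mat (map_mat alpha a)" for x
  proof -
    obtain i j where ij: "i < dim_row a" "j < dim_col a" "x = alpha (a $$ (i, j))"
      using elements_matD[OF x] by (elim exE conjE) simp
    have "a $$ (i, j) \<in> elements_mat a"
      by (rule elements_matI[of a "dim_row a" "dim_col a"]) (simp_all add: ij(1,2))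
    then have "a $$ (i, j) \<in> D1" using assms unfolding mats_def by (elim CollectE conjE subsetD)
    then show ?thesis unfolding ij(3) by (rule alpha_D1)
  qed
  moreover have "map_mat alpha a \<in> matsA k"
    using assms alpha_matsA unfolding mats_def by (elim CollectE conjE)
  ultimately show ?thesis unfolding mats_def by (intro CollectI conjI subsetI)
qed

text \<open>With \<open>u\<^sub>i = n\<^sub>i t\<close> and \<open>w\<^sub>i = t\<^sup>* u\<^sub>i = \<alpha> n\<^sub>i\<close>, the side condition \<open>t\<^sup>* t w\<^sub>i = w\<^sub>i\<close> of the
  first generating rule is \<open>t\<^sup>* t t\<^sup>* = t\<^sup>*\<close>.\<close>

lemma schwarz_mat_le:
  "mat_le k (mat k k (\<lambda>(i, j). star (alpha (n i)) * alpha (n j)))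
            (mat k k (\<lambda>(i, j). alpha (star (n i) * n j)))"
proof -
  define u where "u = vec k (\<lambda>i. n i * cls [1])"
  define w where "w = row_act (cls [-1]) u"
  have "cls [-1, 1] = cls [-1] * cls [1]"
    by (simp add: cls_mult alt_word_singleton word_mult_def)
  then have "cls [-1, 1] * (cls [-1] * x) = cls [-1] * x" for x
    using letter_partial_isometry[of "-1"] by (simp flip: mult.assoc)
  then have "row_act (cls [-1, 1]) w = w"
    by (intro eq_vecI) (auto simp: w_def row_act_def)
  then have "mat_le k (gram w) (gram u)"
    by (intro mat_le.neg) (auto simp: w_def u_def row_act_def)
  moreover have "gram w = mat k k (\<lambda>(i, j). star (alpha (n i)) * alpha (n j))"
    by (rule eq_matI) (auto simp: gram_def w_def u_def row_act_def alpha_def mult.assoc)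
  moreover have "gram u = mat k k (\<lambda>(i, j). alpha (star (n i) * n j))"
    by (rule eq_matI) (auto simp: gram_def u_def alpha_def star_mult star_letter mult.assoc)
  ultimately show ?thesis by simp
qed

lemma mat_le_matsA: "mat_le k a b \<Longrightarrow> a \<in> matsA k \<and> b \<in> matsA k"
  by (induction rule: mat_le.induct) (auto simp: matsA_def)

theorem proposition5p22:
  shows "(\<forall>n\<in>D1. alpha n \<in> D1 \<and> alpha (star n) = star (alpha n)) \<and>
    (\<forall>k\<ge>1. \<forall>a b. mats_le D1 k a b \<longrightarrow>
       map_mat alpha a \<in> mats D1 k \<and> map_mat alpha b \<in> mats D1 k \<and>
       mats_le D1 k (map_mat alpha a) (map_mat alpha b)) \<and>
    (\<forall>k\<ge>1. \<forall>n :: nat \<Rightarrow> A. (\<forall>i<k. n i \<in> D1) \<longrightarrow>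
       mats_le D1 k (mat k k (\<lambda>(i, j). star (alpha (n i)) * alpha (n j)))
                    (mat k k (\<lambda>(i, j). alpha (star (n i) * n j))))"
proof (intro conjI ballI allI impI)
  fix k :: nat and n :: "nat \<Rightarrow> A"
  assume n: "\<forall>i<k. n i \<in> D1"
  let ?S = "mat k k (\<lambda>(i, j). star (alpha (n i)) * alpha (n j))"
  let ?T = "mat k k (\<lambda>(i, j). alpha (star (n i) * n j))"
  have "elements_mat ?S \<subseteq> D1" "elements_mat ?T \<subseteq> D1"
    using n by (auto simp: elements_mat_def intro!: D1_mult D1_star alpha_D1)
  then show "mats_le D1 k ?S ?T"
    using schwarz_mat_le[of k n] mat_le_matsA[OF schwarz_mat_le[of k n]]
    unfolding mats_le_def mats_def by simp
qed (simp_all add: mats_le_def alpha_D1 alpha_star alpha_mats alpha_mat_le)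

end
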